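(* Let $\Delta\ge 3$ and let $A$ be a greedy adaptive priority algorithm in the vertex model. Then there is a graph $G$ with maximum degree at most $\Delta$ such that the matching computed by $A$ on $G$ has size at most $\frac{\Delta-1}{2\Delta-3}\,\nu(G)$.
   Context: $\nu(G)$ is the size of a maximum matching of a finite simple graph $G$. Vertex model: for a node $u$ with neighbors $v_1,\dots,v_d$ in the input graph, the data item of $u$ is $\langle u;v_1,\dots,v_d\rangle$; node identifiers come from a fixed universe. An adaptive priority algorithm proceeds in rounds; in each round it deterministically chooses, as a function only of the data items received and decisions made so far (without otherwise looking at the input), a total order $\pi$ on all possible data items, and receives the first data item (w.r.t. $\pi$) of the input whose node $u$ is still matchable (neither matched nor isolated); it then irrevocably either matches $u$ to a matchable neighbor or isolates $u$. This repeats until no matchable node with a matchable neighbor remains. It is greedy if it never isolates $u$, i.e., always matches $u$ to some matchable neighbor. *)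

theory Defs
  imports Complex_Main
begin

definition simple_graph :: "'v set \<Rightarrow> 'v set set \<Rightarrow> bool" where
  "simple_graph V E \<longleftrightarrow> finite V \<and> (\<forall>e\<in>E. e \<subseteq> V \<and> card e = 2)"

definition neighbors :: "'v set set \<Rightarrow> 'v \<Rightarrow> 'v set" where
  "neighbors E u = {v. {u, v} \<in> E}"

definition is_matching :: "'v set set \<Rightarrow> 'v set set \<Rightarrow> bool" where
  "is_matching E M \<longleftrightarrow> M \<subseteq> E \<and> (\<forall>e\<in>M. \<forall>f\<in>M. e \<noteq> f \<longrightarrow> e \<inter> f = {})"

definition matching_number :: "'v set set \<Rightarrow> nat" where
  "matching_number E = Max (card ` {M. is_matching E M})"

text \<open>
  A data item \<open>(u, N)\<close> lists a node together with its set of neighbors; \<open>N\<close> is a set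
  rather than a list, so an item carries no information beyond the adjacency.
\<close>

type_synonym 'v item = "'v \<times> 'v set"

definition data_items :: "'v item set" where
  "data_items = {(u, N). finite N \<and> u \<notin> N}"

text \<open>
  A history records, oldest round first, the items received and the decisions taken:
  \<open>Some v\<close> matches the received node to \<open>v\<close>, and \<open>None\<close> isolates it.
\<close>

type_synonym 'v history = "('v item \<times> 'v option) list"

definition matching_of :: "'v history \<Rightarrow> 'v set set" where
  "matching_of h = {{u, v} |u v. \<exists>N. ((u, N), Some v) \<in> set h}"

definition isolated_nodes :: "'v history \<Rightarrow> 'v set" where
  "isolated_nodes h = {u. \<exists>N. ((u, N), None) \<in> set h}"

definition matchable :: "'v set \<Rightarrow> 'v history \<Rightarrow> 'v set" where
  "matchable V h = V - \<Union>(matching_of h) - isolated_nodes h"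

definition finished :: "'v set \<Rightarrow> 'v set set \<Rightarrow> 'v history \<Rightarrow> bool" where
  "finished V E h \<longleftrightarrow> (\<forall>u\<in>matchable V h. neighbors E u \<inter> matchable V h = {})"

text \<open>
  The order and the decision are functions of the history (and of the item just received)
  only, which makes the algorithm deterministic and independent of the unseen input.
\<close>

record 'v algorithm =
  priority :: "'v history \<Rightarrow> 'v item rel"
  decide :: "'v history \<Rightarrow> 'v item \<Rightarrow> 'v option"

definition receives ::
  "'v algorithm \<Rightarrow> 'v set \<Rightarrow> 'v set set \<Rightarrow> 'v history \<Rightarrow> 'v item \<Rightarrow> bool" where
  "receives A V E h it \<longleftrightarrow>
     it \<in> (\<lambda>u. (u, neighbors E u)) ` matchable V h \<and>
     (\<forall>u\<in>matchable V h. (it, (u, neighbors E u)) \<in> priority A h)"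

inductive run :: "'v algorithm \<Rightarrow> 'v set \<Rightarrow> 'v set set \<Rightarrow> 'v history \<Rightarrow> bool"
  for A V E where
  start: "run A V E []"
| round: "run A V E h \<Longrightarrow> \<not> finished V E h \<Longrightarrow> receives A V E h it
    \<Longrightarrow> run A V E (h @ [(it, decide A h it)])"

definition complete_run :: "'v algorithm \<Rightarrow> 'v set \<Rightarrow> 'v set set \<Rightarrow> 'v history \<Rightarrow> bool" where
  "complete_run A V E h \<longleftrightarrow> run A V E h \<and> finished V E h"

definition computed_matching :: "'v algorithm \<Rightarrow> 'v set \<Rightarrow> 'v set set \<Rightarrow> 'v set set" where
  "computed_matching A V E = matching_of (THE h. complete_run A V E h)"

text \<open>
  Legality of decisions is only demanded in situations that arise on some input graph.
\<close>

definition adaptive_priority_algorithm :: "'v algorithm \<Rightarrow> bool" where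
  "adaptive_priority_algorithm A \<longleftrightarrow>
     (\<forall>h. linear_order_on data_items (priority A h)) \<and>
     (\<forall>V E h u N v. simple_graph V E \<longrightarrow> run A V E h \<longrightarrow> \<not> finished V E h \<longrightarrow>
        receives A V E h (u, N) \<longrightarrow> decide A h (u, N) = Some v \<longrightarrow> v \<in> N \<inter> matchable V h)"

text \<open>
  A received node all of whose neighbors are already matched or isolated cannot be matched,
  so isolating it does not violate greediness.
\<close>

definition greedy :: "'v algorithm \<Rightarrow> bool" where
  "greedy A \<longleftrightarrow>
     (\<forall>V E h u N. simple_graph V E \<longrightarrow> run A V E h \<longrightarrow> \<not> finished V E h \<longrightarrow>
        receives A V E h (u, N) \<longrightarrow> N \<inter> matchable V h \<noteq> {} \<longrightarrow>
        (\<exists>v \<in> N \<inter> matchable V h. decide A h (u, N) = Some v))"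

text \<open>
  On every input graph the run is unique and terminates, so the definite description in
  \<open>computed_matching\<close> is well defined.
\<close>

lemma item_in_data_items:
  assumes "simple_graph V E"
  shows "(u, neighbors E u) \<in> data_items"
proof -
  have "neighbors E u \<subseteq> V" "u \<notin> neighbors E u"
    using assms by (auto simp: simple_graph_def neighbors_def)
  with assms show ?thesis
    by (auto simp: data_items_def simple_graph_def dest: finite_subset)
qed

lemma linear_order_least:
  assumes "linear_order_on S r" "finite X" "X \<noteq> {}" "X \<subseteq> S"
  shows "\<exists>x\<in>X. \<forall>y\<in>X. (x, y) \<in> r"
  using assms(2,3,4)
proof (induction X rule: finite_ne_induct)
  case (singleton x)
  then show ?case using assms(1)
    by (auto simp: order_on_defs refl_on_def)
next
  case (insert x F)
  then obtain m where m: "m \<in> F" "\<forall>y\<in>F. (m, y) \<in> r" by auto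
  have refl: "(x, x) \<in> r"
    using assms(1) insert.prems by (auto simp: order_on_defs refl_on_def)
  have tr: "trans r" using assms(1) by (auto simp: order_on_defs)
  have "(x, m) \<in> r \<or> (m, x) \<in> r"
    using assms(1) insert.prems insert.hyps m(1) refl
    by (auto simp: order_on_defs total_on_def)
  then show ?case
  proof
    assume "(x, m) \<in> r"
    then have "\<forall>y\<in>insert x F. (x, y) \<in> r"
      using m(2) refl transD[OF tr] by blast
    then show ?thesis by blast
  next
    assume "(m, x) \<in> r"
    then show ?thesis using m by blast
  qed
qed

lemma ex1_receives:
  assumes "adaptive_priority_algorithm A" "simple_graph V E" "matchable V h \<noteq> {}"
  shows "\<exists>!it. receives A V E h it"
proof -
  let ?X = "(\<lambda>u. (u, neighbors E u)) ` matchable V h"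
  have lin: "linear_order_on data_items (priority A h)"
    using assms(1) by (simp add: adaptive_priority_algorithm_def)
  have "finite ?X" "?X \<noteq> {}" "?X \<subseteq> data_items"
    using assms(2,3) item_in_data_items[OF assms(2)]
    by (auto simp: matchable_def simple_graph_def)
  from linear_order_least[OF lin this] obtain it where "receives A V E h it"
    unfolding receives_def by blast
  moreover have "it = it'" if "receives A V E h it" "receives A V E h it'" for it it'
    using that lin unfolding receives_def order_on_defs
    by (auto dest: antisymD)
  ultimately show ?thesis by blast
qed

lemma run_deterministic:
  assumes A: "adaptive_priority_algorithm A" and G: "simple_graph V E"
  shows "run A V E h \<Longrightarrow> run A V E h' \<Longrightarrow> length h \<le> length h' \<Longrightarrow> \<exists>t. h' = h @ t"
proof (induction h rule: run.induct)
  case start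
  then show ?case by simp
next
  case (round h it)
  then obtain t where t: "h' = h @ t" by auto
  have prefix_round: "run A V E g \<Longrightarrow> g = h @ t \<Longrightarrow> t \<noteq> [] \<Longrightarrow>
      \<exists>it' t'. receives A V E h it' \<and> t = (it', decide A h it') # t'" for g t
  proof (induction g arbitrary: t rule: run.induct)
    case start
    then show ?case by simp
  next
    case (round g jt)
    from round.prems obtain s where s: "t = s @ [(jt, decide A g jt)]" "g = h @ s"
      by (metis append_assoc append_butlast_last_id butlast_append butlast_snoc last_appendR last_snoc)
    show ?case
    proof (cases "s = []")
      case True
      then show ?thesis using s round.hyps by (intro exI[of _ jt] exI[of _ "[]"]) auto
    next
      case False
      then show ?thesis using round.IH[OF s(2)] s(1) by auto
    qed
  qed
  have "t \<noteq> []" using t round.prems(2) by auto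
  then obtain it' t' where it': "receives A V E h it'" "t = (it', decide A h it') # t'"
    using prefix_round[OF round.prems(1) t] by blast
  have "matchable V h \<noteq> {}" using round.hyps(2) by (auto simp: finished_def)
  then have "it' = it" using ex1_receives[OF A G] it'(1) round.hyps(3) by blast
  then show ?case using t it'(2) by simp
qed

lemma not_finished_if_proper_prefix:
  "run A V E g \<Longrightarrow> g = h @ t \<Longrightarrow> t \<noteq> [] \<Longrightarrow> \<not> finished V E h"
proof (induction g arbitrary: t rule: run.induct)
  case start
  then show ?case by simp
next
  case (round g jt)
  from round.prems obtain s where s: "t = s @ [(jt, decide A g jt)]" "g = h @ s"
    by (metis append_assoc append_butlast_last_id butlast_append butlast_snoc last_appendR last_snoc)
  show ?case
  proof (cases "s = []")
    case True
    then show ?thesis using s round.hyps by auto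
  next
    case False
    then show ?thesis using round.IH[OF s(2)] by auto
  qed
qed

lemma card_matchable_round:
  assumes "finite V" "receives A V E h it"
  shows "card (matchable V (h @ [(it, d)])) < card (matchable V h)"
proof (rule psubset_card_mono)
  show "finite (matchable V h)" using assms(1) by (simp add: matchable_def)
  obtain u where u: "u \<in> matchable V h" "it = (u, neighbors E u)"
    using assms(2) by (auto simp: receives_def)
  have "u \<notin> matchable V (h @ [(it, d)])"
    using u(2) by (cases d) (auto simp: matchable_def matching_of_def isolated_nodes_def)
  moreover have "matchable V (h @ [(it, d)]) \<subseteq> matchable V h"
    by (auto simp: matchable_def matching_of_def isolated_nodes_def)
  ultimately show "matchable V (h @ [(it, d)]) \<subset> matchable V h"
    using u(1) by blast
qed

lemma ex1_complete_run:
  assumes A: "adaptive_priority_algorithm A" and G: "simple_graph V E"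
  shows "\<exists>!h. complete_run A V E h"
proof -
  have ex: "run A V E h \<Longrightarrow> \<exists>h'. complete_run A V E h'" for h
  proof (induction "card (matchable V h)" arbitrary: h rule: less_induct)
    case less
    show ?case
    proof (cases "finished V E h")
      case True
      then show ?thesis using less.prems by (auto simp: complete_run_def)
    next
      case False
      then have "matchable V h \<noteq> {}" by (auto simp: finished_def)
      then obtain it where it: "receives A V E h it" using ex1_receives[OF A G] by blast
      have "finite V" using G by (simp add: simple_graph_def)
      show ?thesis
        using less.hyps[OF card_matchable_round[OF \<open>finite V\<close> it]] run.round[OF less.prems False it]
        by blast
    qed
  qed
  have uniq: "h = h'"
    if hh: "complete_run A V E h" "complete_run A V E h'" "length h \<le> length h'" for h h'
  proof -
    obtain t where t: "h' = h @ t"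
      using run_deterministic[OF A G, of h h'] hh unfolding complete_run_def by blast
    show ?thesis
      using not_finished_if_proper_prefix[of A V E h' h t] t hh
      unfolding complete_run_def by (cases "t = []") auto
  qed
  show ?thesis
    using ex[OF run.start] uniq by (metis nat_le_linear)
qed

end

theory Submission
  imports Defs
begin

text \<open>
  The adversary makes every round except the last one lose two edges of an optimal matching.
  A received node \<open>r\<close> that is matched to \<open>s\<close> and has at least two further current neighbors is
  put, with \<open>s\<close>, at the center of a complete split graph whose other nodes are exposed at once.
  If \<open>r\<close> has a single further current neighbor \<open>e\<close>, then \<open>r\<close>, \<open>s\<close>, \<open>e\<close> form a triangle:
  the optimal matching uses \<open>re\<close>, and \<open>s\<close>, whose item was never shown, becomes pending, that is,
  it is to be matched optimally to a node that the algorithm has not yet seen.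
  In the last but one round the rest of the graph consists of two centers \<open>v\<close>, \<open>w\<close> with common
  neighbors \<open>L\<close> and a path \<open>v u x w\<close>, each pending node having its own partner in \<open>L\<close>. Whatever
  node is received now can play the role of \<open>u\<close> or \<open>v\<close>, so that \<open>uv\<close> gets matched and only a
  star at \<open>w\<close> remains. A center has degree \<open>|P| + 3\<close>, which leaves room for \<open>\<Delta> - 3\<close> rounds before
  this one, and the optimal matching has \<open>2 (\<Delta> - 3) + 3\<close> edges against
  \<open>(\<Delta> - 3) + 2\<close> of the algorithm.

  So that an item attached to a pending node gives nothing away, a later triangle node \<open>r\<close>
  or the node \<open>u\<close> may be adjacent to one pending node as well (the set \<open>Q\<close> below).
\<close>

section \<open>The configurations that the adversary keeps in reserve\<close>

definition theta_edges ::
  "'v \<Rightarrow> 'v \<Rightarrow> 'v \<Rightarrow> 'v \<Rightarrow> 'v set \<Rightarrow> ('v \<Rightarrow> 'v) \<Rightarrow> 'v set \<Rightarrow> 'v set \<Rightarrow> 'v set set" where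
  "theta_edges u v w x L f P Q =
     {{u, v}, {u, x}, {x, w}} \<union> (\<lambda>l. {v, l}) ` L \<union> (\<lambda>l. {w, l}) ` L
     \<union> (\<lambda>p. {p, f p}) ` P \<union> (\<lambda>p. {u, p}) ` Q"

text \<open>For \<open>I = {e}\<close> this is the triangle, for larger \<open>I\<close> the
  complete split graph; only the received node \<open>r\<close> is given edges to earlier pending
  nodes.\<close>

definition fan_edges :: "'v \<Rightarrow> 'v \<Rightarrow> 'v set \<Rightarrow> 'v set \<Rightarrow> 'v set set" where
  "fan_edges r s I Q =
     {{r, s}} \<union> (\<lambda>e. {r, e}) ` I \<union> (\<lambda>e. {s, e}) ` I \<union> (\<lambda>p. {r, p}) ` Q"

text \<open>
  \<open>n\<close> is the number of rounds to come before the last two, \<open>P\<close> is the set of pending nodes, and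
  \<open>W\<close> is the set of unused node names, finite so that the priority order has a least item.
\<close>

inductive hard :: "nat \<Rightarrow> nat \<Rightarrow> 'v set \<Rightarrow> 'v set \<Rightarrow> 'v set set \<Rightarrow> bool" for D where
  theta: "\<lbrakk>finite P; finite W; P \<inter> W = {}; card P + 3 \<le> D;
     distinct [u, v, w, x]; {u, v, w, x} \<subseteq> W; L \<subseteq> W - {u, v, w, x}; card L = card P + 2;
     inj_on f P; f ` P \<subseteq> L; Q \<subseteq> P; card Q \<le> 1\<rbrakk>
   \<Longrightarrow> hard D 0 P W (theta_edges u v w x L f P Q)"
| fan: "\<lbrakk>finite P; finite W; P \<inter> W = {}; card P + Suc n + 3 \<le> D;
     r \<noteq> s; {r, s} \<subseteq> W; I \<subseteq> W - {r, s}; Q \<subseteq> P;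
     card I = 1 \<and> P' = insert s P \<and> card Q \<le> 1
       \<or> 2 \<le> card I \<and> card I < D \<and> P' = P \<and> Q = {};
     hard D n P' (W - {r, s} - I) E\<rbrakk>
   \<Longrightarrow> hard D (Suc n) P W (fan_edges r s I Q \<union> E)"

section \<open>Neighborhoods in the two kinds of gadgets\<close>

lemma neighbors_Un: "neighbors (E \<union> F) u = neighbors E u \<union> neighbors F u"
  by (auto simp: neighbors_def)

lemma neighbors_insert:
  "neighbors (insert {a, b} E) y =
     (if y = a then {b} else {}) \<union> (if y = b then {a} else {}) \<union> neighbors E y"
  by (auto simp: neighbors_def doubleton_eq_iff)

lemma neighbors_empty: "neighbors {} y = {}"
  by (simp add: neighbors_def)

lemma neighbors_star:
  "neighbors ((\<lambda>l. {a, l}) ` L) y = (if y = a then L else {}) \<union> (if y \<in> L then {a} else {})"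
  by (auto simp: neighbors_def doubleton_eq_iff)

lemma neighbors_graph:
  "neighbors ((\<lambda>p. {p, f p}) ` P) y = (if y \<in> P then {f y} else {}) \<union> {p \<in> P. f p = y}"
  by (auto simp: neighbors_def doubleton_eq_iff)

lemmas neighbors_simps =
  neighbors_Un neighbors_insert neighbors_empty neighbors_star neighbors_graph

lemma neighbors_empty_if_notin: "u \<notin> \<Union>E \<Longrightarrow> neighbors E u = {}"
  by (auto simp: neighbors_def)

lemma neighbors_subset: "neighbors E u \<subseteq> \<Union>E"
  by (auto simp: neighbors_def)

lemma neighbors_fan:
  assumes "r \<noteq> s" "r \<notin> I" "s \<notin> I" "r \<notin> Q" "s \<notin> Q" "I \<inter> Q = {}"
  shows "neighbors (fan_edges r s I Q) r = insert s (I \<union> Q)"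
    and "neighbors (fan_edges r s I Q) s = insert r I"
    and "e \<in> I \<Longrightarrow> neighbors (fan_edges r s I Q) e = {r, s}"
    and "p \<in> Q \<Longrightarrow> neighbors (fan_edges r s I Q) p = {r}"
    and "y \<notin> {r, s} \<union> I \<union> Q \<Longrightarrow> neighbors (fan_edges r s I Q) y = {}"
  using assms unfolding fan_edges_def neighbors_simps by (auto split: if_splits)

lemma neighbors_theta:
  assumes "distinct [u, v, w, x]" "{u, v, w, x} \<inter> (L \<union> P) = {}" "L \<inter> P = {}"
    "f ` P \<subseteq> L" "Q \<subseteq> P"
  shows "neighbors (theta_edges u v w x L f P Q) u = {v, x} \<union> Q"
    and "neighbors (theta_edges u v w x L f P Q) v = insert u L"
    and "neighbors (theta_edges u v w x L f P Q) w = insert x L"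
    and "neighbors (theta_edges u v w x L f P Q) x = {u, w}"
    and "l \<in> L \<Longrightarrow> neighbors (theta_edges u v w x L f P Q) l = {v, w} \<union> {p \<in> P. f p = l}"
    and "p \<in> P \<Longrightarrow> neighbors (theta_edges u v w x L f P Q) p
           = insert (f p) (if p \<in> Q then {u} else {})"
proof -
  have "u \<noteq> v" "u \<noteq> w" "u \<noteq> x" "v \<noteq> w" "v \<noteq> x" "w \<noteq> x"
    "u \<notin> L" "v \<notin> L" "w \<notin> L" "x \<notin> L" "u \<notin> P" "v \<notin> P" "w \<notin> P" "x \<notin> P"
    "u \<notin> Q" "v \<notin> Q" "w \<notin> Q" "x \<notin> Q" "u \<notin> f ` P" "v \<notin> f ` P" "w \<notin> f ` P" "x \<notin> f ` P"
    "\<And>l. l \<in> L \<Longrightarrow> l \<notin> P \<and> l \<notin> Q \<and> l \<noteq> u \<and> l \<noteq> v \<and> l \<noteq> w \<and> l \<noteq> x"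
    "\<And>p. p \<in> P \<Longrightarrow> p \<notin> L \<and> f p \<notin> P \<and> p \<noteq> u \<and> p \<noteq> v \<and> p \<noteq> w \<and> p \<noteq> x"
    using assms by auto
  note facts = this
  show "neighbors (theta_edges u v w x L f P Q) u = {v, x} \<union> Q"
    "neighbors (theta_edges u v w x L f P Q) v = insert u L"
    "neighbors (theta_edges u v w x L f P Q) w = insert x L"
    "neighbors (theta_edges u v w x L f P Q) x = {u, w}"
    unfolding theta_edges_def neighbors_simps using facts(1-22) by auto
  show "neighbors (theta_edges u v w x L f P Q) l = {v, w} \<union> {p \<in> P. f p = l}" if "l \<in> L"
    unfolding theta_edges_def neighbors_simps using facts(23)[OF that] that by auto
  show "neighbors (theta_edges u v w x L f P Q) p = insert (f p) (if p \<in> Q then {u} else {})"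
    if "p \<in> P"
    unfolding theta_edges_def neighbors_simps using facts(24) that by auto
qed

lemma Union_fan: "\<Union>(fan_edges r s I Q) = {r, s} \<union> I \<union> Q"
  by (auto simp: fan_edges_def)

lemma Union_theta:
  "f ` P \<subseteq> L \<Longrightarrow> Q \<subseteq> P \<Longrightarrow> \<Union>(theta_edges u v w x L f P Q) = {u, v, w, x} \<union> L \<union> P"
  by (auto simp: theta_edges_def)

section \<open>Edges and pending degrees of hard configurations\<close>

lemma hard_edges:
  assumes "hard D n P W E"
  shows "finite E \<and> (\<forall>e\<in>E. e \<subseteq> P \<union> W \<and> card e = 2 \<and> e \<inter> W \<noteq> {}) \<and> E \<noteq> {}"
  using assms
proof induction
  case (theta P W u v w x L f Q)
  have fin: "finite L" "finite Q"
    using theta.hyps by (meson finite_Diff finite_subset)+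
  have pair: "{a, b} \<subseteq> P \<union> W \<and> card {a, b} = 2 \<and> {a, b} \<inter> W \<noteq> {}"
    if "a \<noteq> b" "a \<in> P \<union> W" "b \<in> W" for a b
    using that by auto
  have "e \<subseteq> P \<union> W \<and> card e = 2 \<and> e \<inter> W \<noteq> {}" if "e \<in> theta_edges u v w x L f P Q" for e
  proof -
    have "\<exists>a b. e = {a, b} \<and> a \<noteq> b \<and> a \<in> P \<union> W \<and> b \<in> W"
      using that unfolding theta_edges_def
    proof (elim UnE imageE)
      assume "e \<in> {{u, v}, {u, x}, {x, w}}"
      then show ?thesis using theta.hyps(5,6) by auto
    next
      fix l assume "e = {v, l}" "l \<in> L"
      then show ?thesis using theta.hyps(5-7) by blast
    next
      fix l assume "e = {w, l}" "l \<in> L"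
      then show ?thesis using theta.hyps(5-7) by blast
    next
      fix p assume "e = {p, f p}" "p \<in> P"
      then show ?thesis using theta.hyps(3,7,10) by blast
    next
      fix p assume "e = {u, p}" "p \<in> Q"
      then have "e = {p, u} \<and> p \<noteq> u \<and> p \<in> P \<union> W \<and> u \<in> W"
        using theta.hyps(3,6,11) by auto
      then show ?thesis by blast
    qed
    then show ?thesis using pair by blast
  qed
  moreover have "finite (theta_edges u v w x L f P Q)" "theta_edges u v w x L f P Q \<noteq> {}"
    using fin theta.hyps(1) by (auto simp: theta_edges_def)
  ultimately show ?case by blast
next
  case (fan P W n r s I Q P' E)
  have "finite I" "finite Q"
    using fan.hyps by (meson finite_Diff finite_subset)+
  then have "finite (fan_edges r s I Q)"
    by (simp add: fan_edges_def)
  moreover have "e \<subseteq> P \<union> W \<and> card e = 2 \<and> e \<inter> W \<noteq> {}" if "e \<in> fan_edges r s I Q" for e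
  proof -
    have "r \<notin> Q" "r \<notin> I" "s \<notin> I" using fan.hyps by auto
    then show ?thesis
      using that fan.hyps by (auto simp: fan_edges_def card_2_iff')
  qed
  moreover have "e \<subseteq> P \<union> W \<and> card e = 2 \<and> e \<inter> W \<noteq> {}" if "e \<in> E" for e
    using fan.IH that fan.hyps(6,9) by blast
  ultimately show ?case
    using fan.IH by blast
qed

text \<open>In the last configuration a pending node sees its partner \<open>f p\<close> and
  possibly \<open>u\<close>; each fan before it contributes at most its \<open>r\<close>. The bound
  keeps the degree of the triangle node \<open>s\<close> within \<open>D\<close>.\<close>

lemma hard_pending:
  assumes "hard D n P W E" "p \<in> P"
  shows "neighbors E p \<subseteq> W \<and> neighbors E p \<noteq> {} \<and> card (neighbors E p) \<le> n + 2"
  using assms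
proof induction
  case (theta P W u v w x L f Q)
  have "{u, v, w, x} \<inter> (L \<union> P) = {}" "L \<inter> P = {}"
    using theta.hyps by auto
  from neighbors_theta(6)[OF theta.hyps(5) this theta.hyps(10,11) theta.prems]
  show ?case using theta.hyps theta.prems by (auto simp: card_insert_if)
next
  case (fan P W n r s I Q P' E)
  have d: "r \<noteq> s" "r \<notin> I" "s \<notin> I" "r \<notin> Q" "s \<notin> Q" "I \<inter> Q = {}"
    using fan.hyps by auto
  have p: "p \<in> P'" "p \<notin> {r, s} \<union> I"
    using fan.hyps fan.prems by auto
  have "neighbors (fan_edges r s I Q) p \<subseteq> {r}"
    using neighbors_fan(4,5)[OF d, of p] p(2) by blast
  then have sub: "neighbors (fan_edges r s I Q \<union> E) p \<subseteq> insert r (neighbors E p)"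
    by (auto simp: neighbors_Un)
  have fin: "finite (neighbors E p)"
    using fan.IH[OF p(1)] fan.hyps(2) by (meson finite_Diff finite_subset)
  have "card (neighbors (fan_edges r s I Q \<union> E) p) \<le> card (insert r (neighbors E p))"
    using sub fin by (intro card_mono) auto
  also have "\<dots> \<le> Suc n + 2"
    using fan.IH[OF p(1)] fin by (simp add: card_insert_if)
  finally show ?case
    using fan.IH[OF p(1)] sub fan.hyps(6) by (auto simp: neighbors_Un)
qed

section \<open>Admissible neighborhoods\<close>

text \<open>
  The sets that the adversary must be prepared to see as the neighborhood of a received node.
  The current neighbors of the node are those in \<open>N - P\<close>, and \<open>N \<inter> P\<close> is what it reveals about
  earlier rounds.
\<close>

definition admissible :: "nat \<Rightarrow> nat \<Rightarrow> 'v set \<Rightarrow> 'v set \<Rightarrow> bool" where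
  "admissible D n P N \<longleftrightarrow> finite N \<and> 2 \<le> card (N - P) \<and> card N \<le> D \<and> card (N \<inter> P) \<le> 1 \<and>
     (N \<inter> P = {} \<or> card (N - P) = 2) \<and>
     (n = 0 \<longrightarrow> card (N - P) = 2 \<or> N \<inter> P = {} \<and> card N = card P + 3)"

lemma admissibleI:
  assumes "N - P = R" "N \<inter> P = Q" "finite R" "finite Q" "2 \<le> card R" "card Q \<le> 1"
    "Q = {} \<or> card R = 2" "card R + card Q \<le> D"
    "n = 0 \<Longrightarrow> card R = 2 \<or> Q = {} \<and> card R = card P + 3"
  shows "admissible D n P N"
proof -
  have "N = R \<union> Q" "R \<inter> Q = {}" using assms(1,2) by auto
  then have "finite N" "card N = card R + card Q"
    using assms(3,4) by (simp_all add: card_Un_disjoint)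
  then show ?thesis
    using assms(5-9) unfolding admissible_def assms(1,2) by auto
qed

lemma hard_item:
  assumes "hard D n P W E" "y \<in> W" "y \<in> \<Union>E"
  shows "neighbors E y \<subseteq> P \<union> W \<and> y \<notin> neighbors E y \<and> admissible D n P (neighbors E y)"
  using assms
proof (induction arbitrary: y)
  case (theta P W u v w x L f Q)
  have d: "{u, v, w, x} \<inter> (L \<union> P) = {}" "L \<inter> P = {}"
    using theta.hyps by auto
  note nb = neighbors_theta[OF theta.hyps(5) d theta.hyps(10,11)]
  have finL: "finite L" using theta.hyps by (meson finite_Diff finite_subset)
  have finQ: "finite Q" using theta.hyps by (meson finite_subset)
  have D: "3 \<le> D" using theta.hyps by simp
  from theta.prems have "y \<in> {u, v, w, x} \<union> L"
    using Union_theta[OF theta.hyps(10,11)] theta.hyps(3) by auto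
  then consider "y = u" | "y = v" | "y = w" | "y = x" | "y \<in> L" by blast
  then show ?case
  proof cases
    case 1
    have "admissible D 0 P ({v, x} \<union> Q)"
    proof (rule admissibleI)
      show "{v, x} \<union> Q - P = {v, x}" "({v, x} \<union> Q) \<inter> P = Q" using d theta.hyps(11) by auto
      show "card {v, x} + card Q \<le> D" using theta.hyps(5,12) D by simp
    qed (use theta.hyps(5,12) finQ in auto)
    moreover have "{v, x} \<union> Q \<subseteq> P \<union> W" "u \<notin> {v, x} \<union> Q"
      using theta.hyps(5,6,11) d by auto
    ultimately show ?thesis unfolding 1 nb(1) by blast
  next
    case 2
    have "admissible D 0 P (insert u L)"
    proof (rule admissibleI)
      show "insert u L - P = insert u L" "insert u L \<inter> P = {}" using d by auto
    qed (use theta.hyps(4,8) finL d in auto)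
    moreover have "insert u L \<subseteq> P \<union> W" "v \<notin> insert u L"
      using theta.hyps(5-7) by auto
    ultimately show ?thesis unfolding 2 nb(2) by blast
  next
    case 3
    have "admissible D 0 P (insert x L)"
    proof (rule admissibleI)
      show "insert x L - P = insert x L" "insert x L \<inter> P = {}" using d by auto
    qed (use theta.hyps(4,8) finL d in auto)
    moreover have "insert x L \<subseteq> P \<union> W" "w \<notin> insert x L"
      using theta.hyps(5-7) by auto
    ultimately show ?thesis unfolding 3 nb(3) by blast
  next
    case 4
    have "admissible D 0 P {u, w}"
    proof (rule admissibleI)
      show "{u, w} - P = {u, w}" "{u, w} \<inter> P = {}" using d by auto
    qed (use theta.hyps(5) D in auto)
    moreover have "{u, w} \<subseteq> P \<union> W" "x \<notin> {u, w}"
      using theta.hyps(5,6) by auto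
    ultimately show ?thesis unfolding 4 nb(4) by blast
  next
    case 5
    \<comment> \<open>Since \<open>f\<close> is injective, a node of \<open>L\<close> is the partner
      of at most one pending node.\<close>
    let ?F = "{p \<in> P. f p = y}"
    have F: "card ?F \<le> 1"
      using theta.hyps(1,9) by (auto simp: card_le_Suc0_iff_eq inj_on_def)
    have "admissible D 0 P ({v, w} \<union> ?F)"
    proof (rule admissibleI)
      show "{v, w} \<union> ?F - P = {v, w}" "({v, w} \<union> ?F) \<inter> P = ?F" using d by auto
      show "card {v, w} + card ?F \<le> D" using theta.hyps(5) F D by simp
    qed (use theta.hyps(1,5) F in auto)
    moreover have "{v, w} \<union> ?F \<subseteq> P \<union> W" "y \<notin> {v, w} \<union> ?F"
      using theta.hyps(5,6) d 5 by auto
    ultimately show ?thesis unfolding nb(5)[OF 5] by blast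
  qed
next
  case (fan P W n r s I Q P' E)
  have d: "r \<noteq> s" "r \<notin> I" "s \<notin> I" "r \<notin> Q" "s \<notin> Q" "I \<inter> Q = {}"
    using fan.hyps by auto
  note nb = neighbors_fan[OF d]
  have finI: "finite I" using fan.hyps by (meson finite_Diff finite_subset)
  have finQ: "finite Q" using fan.hyps by (meson finite_subset)
  have IP: "I \<inter> P = {}" "r \<notin> P" "s \<notin> P" using fan.hyps by auto
  have I1: "1 \<le> card I" "card I < D" using fan.hyps(4,9) by auto
  have UE: "\<Union>E \<subseteq> P' \<union> (W - {r, s} - I)"
    using hard_edges[OF fan.hyps(10)] by blast
  \<comment> \<open>\<open>r\<close> and the exposed nodes get no further edges from
    \<open>E\<close>; only \<open>s\<close> may, namely when it becomes pending.\<close>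
  have rE: "neighbors E r = {}" and eE: "\<And>e. e \<in> I \<Longrightarrow> neighbors E e = {}"
    using UE IP fan.hyps(5,9) d by (auto intro!: neighbors_empty_if_notin)
  consider "y = r" | "y \<in> I" | "y = s" | "y \<in> W - {r, s} - I" using fan.prems by blast
  then show ?case
  proof cases
    case 1
    have N: "neighbors (fan_edges r s I Q \<union> E) r = insert s (I \<union> Q)"
      using nb(1) rE by (simp add: neighbors_Un)
    have "admissible D (Suc n) P (insert s (I \<union> Q))"
    proof (rule admissibleI)
      show "insert s (I \<union> Q) - P = insert s I" "insert s (I \<union> Q) \<inter> P = Q"
        using IP fan.hyps(8) by auto
    qed (use d finI finQ fan.hyps(4,9) in auto)
    moreover have "insert s (I \<union> Q) \<subseteq> P \<union> W" "r \<notin> insert s (I \<union> Q)"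
      using d fan.hyps(6-8) by auto
    ultimately show ?thesis unfolding 1 N by blast
  next
    case 2
    have N: "neighbors (fan_edges r s I Q \<union> E) y = {r, s}"
      using nb(3)[OF 2] eE[OF 2] by (simp add: neighbors_Un)
    have "admissible D (Suc n) P {r, s}"
    proof (rule admissibleI)
      show "{r, s} - P = {r, s}" "{r, s} \<inter> P = {}" using IP by auto
    qed (use d fan.hyps(4) in auto)
    moreover have "y \<notin> {r, s}" using d 2 by auto
    ultimately show ?thesis unfolding N using fan.hyps(6) by blast
  next
    case 3
    show ?thesis
    proof (cases "card I = 1")
      case True
      then have "s \<in> P'" using fan.hyps(9) by auto
      \<comment> \<open>\<open>s\<close> has two neighbors in the triangle and at most
        \<open>n + 2\<close> later ones, and \<open>n + 4 \<le> D\<close>.\<close>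
      note pend = hard_pending[OF fan.hyps(10) this]
      have finE: "finite (neighbors E s)"
        using pend fan.hyps(2) by (meson finite_Diff finite_subset)
      have dj: "insert r I \<inter> neighbors E s = {}" using pend by auto
      have N: "neighbors (fan_edges r s I Q \<union> E) s = insert r I \<union> neighbors E s"
        using nb(2) by (simp add: neighbors_Un)
      have c: "card (insert r I \<union> neighbors E s) = 2 + card (neighbors E s)"
        using True d finI finE dj by (subst card_Un_disjoint) auto
      have "admissible D (Suc n) P (insert r I \<union> neighbors E s)"
      proof (rule admissibleI)
        show "(insert r I \<union> neighbors E s) \<inter> P = {}" using pend fan.hyps(3) IP by auto
        then show "insert r I \<union> neighbors E s - P = insert r I \<union> neighbors E s" by auto
      qed (use c finI finE pend fan.hyps(4) in auto)
      moreover have "insert r I \<union> neighbors E s \<subseteq> P \<union> W" "s \<notin> insert r I \<union> neighbors E s"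
        using pend fan.hyps(6,7) d by auto
      ultimately show ?thesis unfolding 3 N by blast
    next
      case False
      then have P': "P' = P" and I2: "2 \<le> card I" using fan.hyps(9) by auto
      then have "neighbors E s = {}"
        using UE IP by (auto intro!: neighbors_empty_if_notin)
      then have N: "neighbors (fan_edges r s I Q \<union> E) s = insert r I"
        using nb(2) by (simp add: neighbors_Un)
      have "admissible D (Suc n) P (insert r I)"
      proof (rule admissibleI)
        show "insert r I - P = insert r I" "insert r I \<inter> P = {}" using IP by auto
      qed (use I1 I2 finI d in auto)
      moreover have "insert r I \<subseteq> P \<union> W" "s \<notin> insert r I"
        using fan.hyps(6,7) d by auto
      ultimately show ?thesis unfolding 3 N by blast
    qed
  next
    case 4
    have y: "y \<notin> {r, s} \<union> I \<union> Q" using 4 fan.hyps by auto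
    then have N: "neighbors (fan_edges r s I Q \<union> E) y = neighbors E y"
      using nb(5) by (simp add: neighbors_Un)
    have "y \<in> \<Union>E" using fan.prems(2) y Union_fan[of r s I Q] by auto
    note IH = fan.IH[OF 4 this]
    let ?N = "neighbors E y"
    have adm: "finite ?N" "2 \<le> card (?N - P')" "card ?N \<le> D" "card (?N \<inter> P') \<le> 1"
      "?N \<inter> P' = {} \<or> card (?N - P') = 2"
      using IH by (auto simp: admissible_def)
    \<comment> \<open>Only \<open>s\<close> can change from pending to current. If it is a neighbor
      of \<open>y\<close>, it is the single pending one, so all of \<open>?N\<close> is current;
      otherwise the split of \<open>?N\<close> stays as it was.\<close>
    have "admissible D (Suc n) P ?N"
    proof (cases "card I = 1 \<and> s \<in> ?N")
      case True
      then have P': "P' = insert s P" using fan.hyps(9) by auto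
      have "?N \<inter> P' = {s}"
        using adm(1,4) True P' card_le_Suc0_iff_eq[of "?N \<inter> P'"] by auto
      then have "?N \<inter> P = {}" "2 \<le> card ?N"
        using P' IP adm(1,2) card_mono[OF adm(1), of "?N - P'"] by auto
      then show ?thesis
        using adm(1,3) by (intro admissibleI[of _ _ ?N "{}"]) auto
    next
      case False
      then have "?N - P = ?N - P'" "?N \<inter> P = ?N \<inter> P'"
        using fan.hyps(9) by auto
      then show ?thesis
        using adm by (simp add: admissible_def)
    qed
    moreover have "?N \<subseteq> P \<union> W" "y \<notin> ?N"
      using IH fan.hyps(6,9) by blast+
    ultimately show ?thesis unfolding N by blast
  qed
qed

section \<open>Large matchings in hard configurations\<close>

lemma is_matching_insert:
  assumes "is_matching E M" "E \<subseteq> F" "finite M" "e \<in> F" "e \<noteq> {}" "e \<inter> \<Union>M = {}"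
  shows "is_matching F (insert e M) \<and> finite (insert e M) \<and> card (insert e M) = Suc (card M)"
proof -
  have "e \<notin> M" using assms by auto
  moreover have "is_matching F (insert e M)"
    using assms unfolding is_matching_def by (simp add: Ball_def) blast
  ultimately show ?thesis using assms(3) by simp
qed

text \<open>Each round is worth two edges: a triangle gives \<open>re\<close> and one more pending
  node to be matched later, a larger fan gives \<open>re\<close> and \<open>se'\<close>. At the end
  each pending node takes its own partner, and \<open>ux\<close>, \<open>vy\<close>,
  \<open>wz\<close> are added.\<close>

lemma hard_matching:
  assumes "hard D n P W E"
  shows "\<exists>M. is_matching E M \<and> finite M \<and> card M = 2 * n + 3 + card P"
  using assms
proof induction
  case (theta P W u v w x L f Q)
  let ?E = "theta_edges u v w x L f P Q"
  let ?M = "(\<lambda>p. {p, f p}) ` P"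
  have disj: "{u, v, w, x} \<inter> (L \<union> P) = {}" "L \<inter> P = {}"
    using theta.hyps by auto
  have fP: "f p \<in> L" "f p \<notin> P" if "p \<in> P" for p
    using that theta.hyps by auto
  have "inj_on (\<lambda>p. {p, f p}) P"
    using fP by (auto simp: inj_on_def doubleton_eq_iff)
  then have cM: "card ?M = card P" by (rule card_image)
  have M: "is_matching ?E ?M"
    unfolding is_matching_def
  proof (intro conjI ballI impI)
    show "?M \<subseteq> ?E" by (auto simp: theta_edges_def)
  next
    fix e e' assume "e \<in> ?M" "e' \<in> ?M" "e \<noteq> e'"
    then obtain p p' where pp: "e = {p, f p}" "e' = {p', f p'}" "p \<in> P" "p' \<in> P" "p \<noteq> p'"
      by auto
    then have "f p \<noteq> f p'" "p \<noteq> f p'" "p' \<noteq> f p"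
      using theta.hyps(9) fP by (auto simp: inj_on_def)
    then show "e \<inter> e' = {}" using pp by auto
  qed
  have "finite L" using theta.hyps by (meson finite_Diff finite_subset)
  moreover have "card (f ` P) = card P" using theta.hyps(9) by (rule card_image)
  \<comment> \<open>\<open>L\<close> has two nodes more than \<open>P\<close>; the two spare ones
    serve \<open>v\<close> and \<open>w\<close>.\<close>
  ultimately have "card (L - f ` P) = 2"
    using theta.hyps by (simp add: card_Diff_subset)
  then obtain y z where yz: "y \<in> L" "z \<in> L" "y \<notin> f ` P" "z \<notin> f ` P" "y \<noteq> z"
    by (metis DiffD1 DiffD2 card_2_iff insertCI)
  have UM: "\<Union>?M \<subseteq> P \<union> f ` P" by auto
  have ne: "u \<noteq> x" "u \<noteq> v" "v \<noteq> x" "w \<noteq> u" "w \<noteq> x" "w \<noteq> v"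
    "\<And>l. l \<in> L \<Longrightarrow> l \<noteq> u \<and> l \<noteq> v \<and> l \<noteq> w \<and> l \<noteq> x \<and> l \<notin> P"
    using theta.hyps(5) disj by auto
  have M1: "is_matching ?E (insert {u, x} ?M) \<and> finite (insert {u, x} ?M)
      \<and> card (insert {u, x} ?M) = Suc (card ?M)"
    using UM disj theta.hyps(1,10) M by (intro is_matching_insert[of ?E]) (auto simp: theta_edges_def)
  have M2: "is_matching ?E (insert {v, y} (insert {u, x} ?M)) \<and> finite (insert {v, y} (insert {u, x} ?M))
      \<and> card (insert {v, y} (insert {u, x} ?M)) = Suc (card (insert {u, x} ?M))"
  proof (intro is_matching_insert[of ?E])
    show "{v, y} \<in> ?E" using yz by (auto simp: theta_edges_def)
    have "v \<notin> P \<union> f ` P" "y \<notin> P \<union> f ` P" "v \<notin> {u, x}" "y \<notin> {u, x}"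
      using ne yz disj theta.hyps(10) by auto
    then show "{v, y} \<inter> \<Union>(insert {u, x} ?M) = {}" using UM by auto
  qed (use M1 in auto)
  have M3: "is_matching ?E (insert {w, z} (insert {v, y} (insert {u, x} ?M)))
      \<and> finite (insert {w, z} (insert {v, y} (insert {u, x} ?M)))
      \<and> card (insert {w, z} (insert {v, y} (insert {u, x} ?M))) = Suc (card (insert {v, y} (insert {u, x} ?M)))"
  proof (intro is_matching_insert[of ?E])
    show "{w, z} \<in> ?E" using yz by (auto simp: theta_edges_def)
    have "w \<notin> P \<union> f ` P" "z \<notin> P \<union> f ` P" "w \<notin> {u, x}" "z \<notin> {u, x}" "w \<notin> {v, y}" "z \<notin> {v, y}"
      using ne yz disj theta.hyps(10) by auto
    then show "{w, z} \<inter> \<Union>(insert {v, y} (insert {u, x} ?M)) = {}" using UM by auto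
  qed (use M2 in auto)
  then show ?case
    using M1 M2 cM by (intro exI[of _ "insert {w, z} (insert {v, y} (insert {u, x} ?M))"]) simp
next
  case (fan P W n r s I Q P' E)
  let ?W' = "W - {r, s} - I"
  let ?F = "fan_edges r s I Q \<union> E"
  obtain M where M: "is_matching E M" "finite M" "card M = 2 * n + 3 + card P'"
    using fan.IH by blast
  have "\<Union>M \<subseteq> \<Union>E" using M(1) by (auto simp: is_matching_def)
  also have "\<dots> \<subseteq> P' \<union> ?W'" using hard_edges[OF fan.hyps(10)] by blast
  finally have UM: "\<Union>M \<subseteq> P' \<union> ?W'" .
  from fan.hyps(9) show ?case
  proof
    assume c: "card I = 1 \<and> P' = insert s P \<and> card Q \<le> 1"
    then obtain e where e: "I = {e}" using card_1_singletonE by blast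
    have "is_matching ?F (insert {r, e} M) \<and> finite (insert {r, e} M)
        \<and> card (insert {r, e} M) = Suc (card M)"
    proof (rule is_matching_insert[OF M(1)])
      have "r \<notin> P" "e \<notin> P" "e \<noteq> s" "e \<noteq> r" using e fan.hyps by auto
      then show "{r, e} \<inter> \<Union>M = {}" using UM c e fan.hyps(5) by auto
    qed (use M e in \<open>auto simp: fan_edges_def\<close>)
    moreover have "s \<notin> P" using fan.hyps(3,6) by auto
    then have "card P' = Suc (card P)" using c fan.hyps(1) by simp
    ultimately show ?thesis using M(3) by (intro exI[of _ "insert {r, e} M"]) auto
  next
    assume c: "2 \<le> card I \<and> card I < D \<and> P' = P \<and> Q = {}"
    then obtain T where "T \<subseteq> I" "card T = 2"
      by (meson obtain_subset_with_card_n)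
    then obtain e e' where e: "e \<in> I" "e' \<in> I" "e \<noteq> e'"
      by (metis card_2_iff insert_subset)
    have ne: "r \<notin> P" "s \<notin> P" "e \<notin> P" "e' \<notin> P" "e \<noteq> s" "e \<noteq> r" "e' \<noteq> s" "e' \<noteq> r"
      using e fan.hyps by auto
    have 1: "is_matching ?F (insert {r, e} M) \<and> finite (insert {r, e} M)
        \<and> card (insert {r, e} M) = Suc (card M)"
    proof (rule is_matching_insert[OF M(1)])
      show "{r, e} \<inter> \<Union>M = {}" using UM c e ne by auto
    qed (use M e in \<open>auto simp: fan_edges_def\<close>)
    have "is_matching ?F (insert {s, e'} (insert {r, e} M)) \<and> finite (insert {s, e'} (insert {r, e} M))
        \<and> card (insert {s, e'} (insert {r, e} M)) = Suc (card (insert {r, e} M))"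
    proof (rule is_matching_insert[of ?F])
      show "{s, e'} \<inter> \<Union>(insert {r, e} M) = {}" using UM c e ne fan.hyps(5) by auto
    qed (use 1 e in \<open>auto simp: fan_edges_def\<close>)
    then show ?thesis
      using M(3) c 1 by (intro exI[of _ "insert {s, e'} (insert {r, e} M)"]) auto
  qed
qed

section \<open>Building a configuration around a received item and its decision\<close>

lemma obtain_injection:
  assumes "finite P" "finite L" "card P \<le> card L"
  obtains f where "inj_on f P" "f ` P \<subseteq> L"
  using that assms(3) inj_on_iff_card_le[OF assms(1,2)] by blast

lemma card_4_distinct:
  assumes "card T = 4"
  shows "\<exists>a b c d. T = {a, b, c, d} \<and> distinct [a, b, c, d]"
proof -
  have "finite T" using assms card.infinite by fastforce
  then obtain xs where xs: "set xs = T" "distinct xs" "length xs = 4"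
    using finite_distinct_list[of T] assms distinct_card by metis
  then obtain a b c d where "xs = [a, b, c, d]"
    by (auto simp: eval_nat_numeral length_Suc_conv)
  then show ?thesis
    using xs by (metis list.set(1) list.set(2))
qed

text \<open>No item is prescribed, so fans with two exposed nodes and \<open>Q = {}\<close> suffice.
  The last configuration takes \<open>card P + 6 \<le> D + 3\<close> names, a fan only four.\<close>

lemma hard_exists:
  assumes "finite P" "finite W" "P \<inter> W = {}" "card P + n + 3 \<le> D" "(n + 1) * (D + 3) \<le> card W"
  shows "\<exists>E. hard D n P W E"
  using assms(2-)
proof (induction n arbitrary: W)
  case 0
  then have "4 \<le> card W" by simp
  then obtain T where "T \<subseteq> W" "card T = 4" "finite T"
    by (meson obtain_subset_with_card_n)
  then obtain u v w x where T: "T = {u, v, w, x}" "distinct [u, v, w, x]" "{u, v, w, x} \<subseteq> W"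
    using card_4_distinct by metis
  have "card P + 2 \<le> card (W - T)"
    using 0 \<open>card T = 4\<close> \<open>finite T\<close> \<open>T \<subseteq> W\<close> by (simp add: card_Diff_subset)
  then obtain L where L: "L \<subseteq> W - T" "card L = card P + 2" "finite L"
    by (meson obtain_subset_with_card_n)
  then obtain f where "inj_on f P" "f ` P \<subseteq> L"
    using obtain_injection[OF assms(1) L(3)] by auto
  then have "hard D 0 P W (theta_edges u v w x L f P {})"
    using 0 assms(1) T L by (intro hard.theta) auto
  then show ?case by blast
next
  case (Suc n)
  have "4 \<le> card W" using Suc.prems by simp
  then obtain T where TW: "T \<subseteq> W" "card T = 4" "finite T"
    by (meson obtain_subset_with_card_n)
  then obtain r s e e' where T: "T = {r, s, e, e'}" "distinct [r, s, e, e']" "{r, s, e, e'} \<subseteq> W"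
    using card_4_distinct by metis
  have "W - {r, s} - {e, e'} = W - T" using T by auto
  moreover have "card (W - T) = card W - 4" using TW by (simp add: card_Diff_subset)
  ultimately have "(n + 1) * (D + 3) \<le> card (W - {r, s} - {e, e'})"
    using Suc.prems(3,4) by simp
  then obtain E where "hard D n P (W - {r, s} - {e, e'}) E"
    using Suc.IH[of "W - {r, s} - {e, e'}"] Suc.prems by auto
  then have "hard D (Suc n) P W (fan_edges r s {e, e'} {} \<union> E)"
    using Suc.prems assms(1) T by (intro hard.fan) auto
  then show ?case by blast
qed

text \<open>With two current neighbors, \<open>r\<close> plays \<open>u\<close> and \<open>s\<close>
  plays \<open>v\<close>. Otherwise \<open>r\<close> plays \<open>v\<close>, \<open>s\<close> plays
  \<open>u\<close>, and the rest of \<open>N\<close> has exactly the size \<open>card P + 2\<close>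
  required of \<open>L\<close>. Either way \<open>rs\<close> is the edge \<open>uv\<close>, and once
  the pending nodes are covered too, only the star at \<open>w\<close> is left.\<close>

lemma theta_realizes:
  assumes "finite P" "finite W" "P \<inter> W = {}" "card P + 3 \<le> D" "D + 3 \<le> card W"
    and "r \<in> W" "N \<subseteq> P \<union> W" "r \<notin> N" "admissible D 0 P N" "s \<in> N - P"
  shows "\<exists>E w. hard D 0 P W E \<and> neighbors E r = N \<and> (\<forall>e\<in>E. e \<inter> ({r, s} \<union> P) = {} \<longrightarrow> w \<in> e)"
proof -
  have N: "finite N" "card N \<le> D" using assms(9) by (auto simp: admissible_def)
  have "card (W - insert r N) \<ge> 2"
  \<comment> \<open>\<open>r\<close> and \<open>N\<close> occupy at most \<open>D + 1\<close> of the
    \<open>D + 3\<close> names, which leaves two: \<open>w\<close>, and \<open>a\<close> in the role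
    of \<open>x\<close> in the second case.\<close>
  proof -
    have "card (insert r N) \<le> D + 1" using N by (simp add: card_insert_if)
    then show ?thesis using diff_card_le_card_Diff[of "insert r N" W] N assms(5) by simp
  qed
  then obtain T where "T \<subseteq> W - insert r N" "card T = 2"
    by (meson obtain_subset_with_card_n)
  then obtain a w where aw: "a \<in> W" "w \<in> W" "a \<noteq> w" "a \<noteq> r" "w \<noteq> r" "a \<notin> N" "w \<notin> N"
    by (metis Diff_iff card_2_iff insertCI insert_subset)
  from assms(9) consider "card (N - P) = 2" | "N \<inter> P = {}" "card N = card P + 3"
    by (auto simp: admissible_def)
  then show ?thesis
  proof cases
    case 1
    then obtain x where x: "N - P = {s, x}" "s \<noteq> x"
      using assms(10) by (metis card_2_iff doubleton_eq_iff insert_iff singletonD)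
    let ?C = "{r, s, w, x}"
    have C: "distinct [r, s, w, x]" "?C \<subseteq> W" using x aw assms by auto
    have "card P + 2 \<le> card (W - ?C)"
      using C assms(2,4,5) by (simp add: card_Diff_subset)
    then obtain L where L: "L \<subseteq> W - ?C" "card L = card P + 2" "finite L"
      by (meson obtain_subset_with_card_n)
    then obtain f where f: "inj_on f P" "f ` P \<subseteq> L"
      using obtain_injection[OF assms(1) L(3)] by auto
    let ?E = "theta_edges r s w x L f P (N \<inter> P)"
    have "hard D 0 P W ?E"
      using assms C L f by (intro hard.theta) (auto simp: admissible_def)
    moreover have "neighbors ?E r = N"
    proof -
      have "?C \<inter> (L \<union> P) = {}" "L \<inter> P = {}" using C(2) L(1) assms(3) by auto
      from neighbors_theta(1)[OF C(1) this f(2), of "N \<inter> P"] show ?thesis using x by auto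
    qed
    moreover have "\<forall>e\<in>?E. e \<inter> ({r, s} \<union> P) = {} \<longrightarrow> w \<in> e"
      by (auto simp: theta_edges_def)
    ultimately show ?thesis by blast
  next
    case 2
    let ?L = "N - {s}"
    have NW: "N \<subseteq> W" using 2 assms(7) by auto
    have C: "distinct [s, r, w, a]" "{s, r, w, a} \<subseteq> W" "?L \<subseteq> W - {s, r, w, a}" "card ?L = card P + 2"
      using aw assms NW 2 by auto
    then obtain f where f: "inj_on f P" "f ` P \<subseteq> ?L"
      using obtain_injection[OF assms(1), of ?L] N(1) by auto
    let ?E = "theta_edges s r w a ?L f P {}"
    have "hard D 0 P W ?E"
      using assms C f by (intro hard.theta) auto
    moreover have "neighbors ?E r = N"
    proof -
      have "{s, r, w, a} \<inter> (?L \<union> P) = {}" "?L \<inter> P = {}" using C(2,3) assms(3) by auto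
      from neighbors_theta(2)[OF C(1) this f(2), of "{}"] show ?thesis using assms(10) by auto
    qed
    moreover have "\<forall>e\<in>?E. e \<inter> ({r, s} \<union> P) = {} \<longrightarrow> w \<in> e"
      by (auto simp: theta_edges_def)
    ultimately show ?thesis by blast
  qed
qed

text \<open>The current neighbors other than \<open>s\<close> become the exposed nodes, so
  \<open>r\<close> sees exactly \<open>N\<close> whatever configuration follows.\<close>

lemma fan_realizes:
  assumes "finite P" "finite W" "P \<inter> W = {}" "card P + Suc n + 3 \<le> D"
    and "(Suc n + 1) * (D + 3) \<le> card W"
    and "r \<in> W" "N \<subseteq> P \<union> W" "r \<notin> N" "admissible D (Suc n) P N" "s \<in> N - P"
  obtains I P' where "I \<subseteq> W - {r, s}" "P' \<subseteq> insert s P" "finite P'"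
    "card P' + n + 3 \<le> D" "(n + 1) * (D + 3) \<le> card (W - {r, s} - I)"
    "\<And>E. hard D n P' (W - {r, s} - I) E \<Longrightarrow> hard D (Suc n) P W (fan_edges r s I (N \<inter> P) \<union> E)"
    "\<And>E. hard D n P' (W - {r, s} - I) E \<Longrightarrow> neighbors (fan_edges r s I (N \<inter> P) \<union> E) r = N"
proof -
  let ?I = "N - P - {s}" and ?Q = "N \<inter> P"
  \<comment> \<open>A single exposed node means a triangle, whose \<open>s\<close> is pending from
    now on.\<close>
  define P' where "P' = (if card ?I = 1 then insert s P else P)"
  have adm: "finite N" "2 \<le> card (N - P)" "card N \<le> D" "card ?Q \<le> 1"
    "?Q = {} \<or> card (N - P) = 2"
    using assms(9) by (auto simp: admissible_def)
  have cI: "card ?I = card (N - P) - 1" using assms(10) adm(1) by simp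
  have cNP: "card (N - P) \<le> card N" using adm(1) by (intro card_mono) auto
  have alt: "card ?I = 1 \<and> P' = insert s P \<and> card ?Q \<le> 1
      \<or> 2 \<le> card ?I \<and> card ?I < D \<and> P' = P \<and> ?Q = {}"
    using adm cI cNP by (auto simp: P'_def)
  have hard: "hard D (Suc n) P W (fan_edges r s ?I ?Q \<union> E)" if "hard D n P' (W - {r, s} - ?I) E" for E
    using assms alt that by (intro hard.fan[of P W n D r s ?I ?Q P']) auto
  have nb: "neighbors (fan_edges r s ?I ?Q \<union> E) r = N" if E: "hard D n P' (W - {r, s} - ?I) E" for E
  proof -
    have "r \<notin> P'" using assms by (auto simp: P'_def)
    then have "r \<notin> \<Union>E" using hard_edges[OF E] by blast
    moreover have "neighbors (fan_edges r s ?I ?Q) r = insert s (?I \<union> ?Q)"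
      using assms by (intro neighbors_fan) auto
    moreover have "insert s (?I \<union> ?Q) = N" using assms(10) by auto
    ultimately show ?thesis by (simp add: neighbors_Un neighbors_empty_if_notin)
  qed
  have "W - {r, s} - ?I = W - insert r (N - P)" using assms(10) by auto
  moreover have "card (insert r (N - P)) \<le> D + 1"
    using adm(1,3) cNP by (simp add: card_insert_if)
  ultimately have "card W - (D + 1) \<le> card (W - {r, s} - ?I)"
    using diff_card_le_card_Diff[of "insert r (N - P)" W] adm(1) by simp
  then have "(n + 1) * (D + 3) \<le> card (W - {r, s} - ?I)" using assms(5) by simp
  \<comment> \<open>\<open>card P\<close> grows by at most one while one round is used up, so the
    degree budget \<open>card P + n + 3 \<le> D\<close> survives.\<close>
  moreover have "card P' \<le> card P + 1" using assms(1) by (simp add: P'_def card_insert_if)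
  ultimately show thesis
    using assms hard nb by (intro that[of ?I P']) (auto simp: P'_def)
qed

section \<open>Runs and the matchings they produce\<close>

lemma matching_of_simps:
  "matching_of [] = {}"
  "matching_of (h @ [((u, N), None)]) = matching_of h"
  "matching_of (h @ [((u, N), Some v)]) = insert {u, v} (matching_of h)"
  by (auto simp: matching_of_def)

lemma isolated_nodes_simps:
  "isolated_nodes [] = {}"
  "isolated_nodes (h @ [((u, N), None)]) = insert u (isolated_nodes h)"
  "isolated_nodes (h @ [((u, N), Some v)]) = isolated_nodes h"
  by (auto simp: isolated_nodes_def)

lemma finite_matching_of: "finite (matching_of h)"
proof -
  have "matching_of h \<subseteq> (\<lambda>((u, N), d). {u, the d}) ` set h"
    by (force simp: matching_of_def)
  then show ?thesis by (rule finite_subset) simp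
qed

lemma run_matching:
  assumes "adaptive_priority_algorithm A" "simple_graph V E" "run A V E h"
  shows "is_matching E (matching_of h)"
  using assms(3)
proof induction
  case start
  then show ?case by (simp add: matching_of_simps is_matching_def)
next
  case (round h it)
  obtain u N where it: "it = (u, N)" by fastforce
  have u: "u \<in> matchable V h" "N = neighbors E u"
    using round.hyps(3) it by (auto simp: receives_def)
  show ?case
  proof (cases "decide A h it")
    case None
    then show ?thesis using round.IH it by (simp add: matching_of_simps)
  next
    case (Some v)
    then have v: "v \<in> N \<inter> matchable V h"
      using assms(1,2) round.hyps it unfolding adaptive_priority_algorithm_def by blast
    have "is_matching E (insert {u, v} (matching_of h))"
      using is_matching_insert[OF round.IH subset_refl finite_matching_of, of "{u, v}"] u v
      by (auto simp: neighbors_def matchable_def)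
    then show ?thesis using it Some by (simp add: matching_of_simps)
  qed
qed

text \<open>By determinism every run is a prefix of the complete one, so the analysis may stop
  before the algorithm does.\<close>

lemma run_matching_subset:
  assumes A: "adaptive_priority_algorithm A" and G: "simple_graph V E" and "run A V E h"
  shows "matching_of h \<subseteq> computed_matching A V E"
    and "is_matching E (computed_matching A V E)"
proof -
  obtain g where g: "complete_run A V E g" "computed_matching A V E = matching_of g"
    using ex1_complete_run[OF A G] theI'[of "complete_run A V E"]
    unfolding computed_matching_def by blast
  then have run: "run A V E g" and fin: "finished V E g" by (auto simp: complete_run_def)
  show "is_matching E (computed_matching A V E)"
    using run_matching[OF A G run] g(2) by simp
  have "\<exists>t. g = h @ t"
  proof (cases "length h \<le> length g")
    case True
    then show ?thesis using run_deterministic[OF A G assms(3) run] by blast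
  next
    case False
    \<comment> \<open>Impossible: \<open>g\<close> would be a proper prefix of a run, hence not
      finished.\<close>
    then obtain t where "h = g @ t"
      using run_deterministic[OF A G run assms(3)] by auto
    then show ?thesis
      using not_finished_if_proper_prefix[OF assms(3)] fin False by fastforce
  qed
  then show "matching_of h \<subseteq> computed_matching A V E"
    using g(2) by (auto simp: matching_of_def)
qed

text \<open>Edges of \<open>M\<close> outside \<open>M'\<close> avoid all nodes covered by
  \<open>M'\<close>, so they pass through \<open>w\<close>; being disjoint, there is at most
  one.\<close>

lemma card_matching_through_node:
  assumes "is_matching E M" "M' \<subseteq> M" "finite M'" "\<forall>e\<in>E. e \<inter> \<Union>M' = {} \<longrightarrow> w \<in> e"
    and "finite E"
  shows "card M \<le> card M' + 1"
proof -
  have M: "M \<subseteq> E" "\<And>e f. e \<in> M \<Longrightarrow> f \<in> M \<Longrightarrow> e \<noteq> f \<Longrightarrow> e \<inter> f = {}"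
    using assms(1) by (auto simp: is_matching_def)
  have w: "w \<in> e" if "e \<in> M - M'" for e
  proof -
    have "e \<inter> f = {}" if "f \<in> M'" for f
      using M(2)[of e f] that \<open>e \<in> M - M'\<close> assms(2) by blast
    then have "e \<inter> \<Union>M' = {}" by auto
    moreover have "e \<in> E" using that M(1) by auto
    ultimately show ?thesis using assms(4) by simp
  qed
  have "finite M" using M(1) assms(5) by (rule finite_subset)
  have "e = f" if "e \<in> M - M'" "f \<in> M - M'" for e f
    using M(2)[of e f] w that by blast
  then have "card (M - M') \<le> 1"
    using \<open>finite M\<close> by (simp add: card_le_Suc0_iff_eq)
  then show ?thesis
    using assms(2,3) \<open>finite M\<close> by (simp add: card_Diff_subset)
qed

section \<open>The game between adversary and algorithm\<close>

text \<open>
  The adversary has committed to the edges \<open>E0\<close>, still has the nodes \<open>W\<close> at its disposal, and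
  every graph completing \<open>E0\<close> by a hard configuration leads the algorithm to the history \<open>h\<close>.
\<close>

definition position ::
  "'v algorithm \<Rightarrow> nat \<Rightarrow> nat \<Rightarrow> 'v set \<Rightarrow> 'v set \<Rightarrow> 'v set set \<Rightarrow> 'v history \<Rightarrow> bool" where
  "position A D n P W E0 h \<longleftrightarrow>
     finite P \<and> finite W \<and> P \<inter> W = {} \<and> card P + n + 3 \<le> D \<and> (n + 1) * (D + 3) \<le> card W \<and>
     finite E0 \<and> \<Union>E0 \<inter> W = {} \<and> (\<forall>e\<in>E0. card e = 2 \<and> e \<inter> \<Union>(matching_of h) \<noteq> {}) \<and>
     P \<subseteq> \<Union>(matching_of h) \<and> \<Union>(matching_of h) \<inter> W = {} \<and> isolated_nodes h \<inter> W = {} \<and>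
     (\<forall>E. hard D n P W E \<longrightarrow> run A (\<Union>(E0 \<union> E)) (E0 \<union> E) h)"

lemma simple_graph_hard:
  assumes "finite E0" "\<forall>e\<in>E0. card e = 2" "hard D n P W E"
  shows "simple_graph (\<Union>(E0 \<union> E)) (E0 \<union> E)"
proof -
  have "finite (E0 \<union> E)" "\<forall>e\<in>E0 \<union> E. card e = 2"
    using assms hard_edges[OF assms(3)] by auto
  then show ?thesis
    unfolding simple_graph_def
    by (metis Sup_upper card.infinite finite_Union zero_neq_numeral)
qed

text \<open>Take the least among the items of all candidate graphs together: every candidate
  containing it receives it, and the decision is the same in each. If its node lies outside
  \<open>W\<close>, all its neighbors are matched and it is isolated, which leaves the matching
  unchanged; hence the induction on exposed nodes not yet isolated.\<close>

lemma position_next_item: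
  assumes A: "adaptive_priority_algorithm A" "greedy A" and "position A D n P W E0 h"
  shows "\<exists>h' r N s E. position A D n P W E0 h' \<and> matching_of h' = matching_of h \<and>
    hard D n P W E \<and> r \<in> W \<and> r \<in> \<Union>E \<and> N = neighbors E r \<and> s \<in> N - P \<and>
    (\<forall>E'. hard D n P W E' \<longrightarrow> neighbors E' r = N \<longrightarrow>
       run A (\<Union>(E0 \<union> E')) (E0 \<union> E') (h' @ [((r, N), Some s)]))"
  using assms(3)
proof (induction "card (\<Union>E0 - isolated_nodes h)" arbitrary: h rule: less_induct)
  case less
  let ?H = "hard D n P W" and ?V = "\<lambda>E. \<Union>(E0 \<union> E)" and ?X = "\<Union>(matching_of h)"
  note pos = less.prems[unfolded position_def]
  have fin: "finite P" "finite W" "P \<inter> W = {}" and E0: "finite E0" "\<Union>E0 \<inter> W = {}"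
    "\<And>e. e \<in> E0 \<Longrightarrow> card e = 2" "\<And>e. e \<in> E0 \<Longrightarrow> e \<inter> ?X \<noteq> {}"
    and X: "P \<subseteq> ?X" "?X \<inter> W = {}" "isolated_nodes h \<inter> W = {}"
    and run: "\<And>E. ?H E \<Longrightarrow> run A (?V E) (E0 \<union> E) h"
    using pos by auto
  have simple: "simple_graph (?V E) (E0 \<union> E)" if "?H E" for E
    using simple_graph_hard[OF E0(1) _ that] E0(3) by blast
  have W_matchable: "y \<in> matchable (?V E) h" if "y \<in> W" "y \<in> \<Union>E" for y E
    using that X unfolding matchable_def by blast
  have nb_W: "neighbors (E0 \<union> E) y = neighbors E y" if "y \<in> W" for y E
    using that E0(2) neighbors_empty_if_notin[of y E0] by (auto simp: neighbors_Un)
  have nb_matchable: "neighbors E y - P \<noteq> {} \<and> neighbors E y - P \<subseteq> matchable (?V E) h"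
    if "?H E" "y \<in> W" "y \<in> \<Union>E" for y E
  proof -
    note it = hard_item[OF that]
    have "admissible D n P (neighbors E y)" using it by simp
    then have "2 \<le> card (neighbors E y - P)" unfolding admissible_def by (elim conjE)
    then have "neighbors E y - P \<noteq> {}" by (intro notI) simp
    moreover have "z \<in> matchable (?V E) h" if "z \<in> neighbors E y - P" for z
      using W_matchable[of z E] it that neighbors_subset[of E y] by blast
    ultimately show ?thesis by blast
  qed
  have unfin: "\<not> finished (?V E) (E0 \<union> E) h" if E: "?H E" for E
  proof -
    obtain e y where "e \<in> E" "y \<in> e" "y \<in> W" using hard_edges[OF E] by blast
    then have y: "y \<in> W" "y \<in> \<Union>E" by auto
    obtain z where "z \<in> neighbors (E0 \<union> E) y \<inter> matchable (?V E) h"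
      using nb_matchable[OF E y] nb_W[OF y(1)] by blast
    then show ?thesis
      unfolding finished_def using W_matchable[OF y] by auto
  qed
  \<comment> \<open>Finite because all candidates live on the nodes
    \<open>P \<union> W\<close>.\<close>
  define S where "S = (\<Union>E\<in>{E. ?H E}. (\<lambda>y. (y, neighbors (E0 \<union> E) y)) ` matchable (?V E) h)"
  have "{E. ?H E} \<subseteq> Pow (Pow (P \<union> W))" using hard_edges by blast
  then have "finite {E. ?H E}" using fin by (simp add: finite_subset)
  moreover have "finite (matchable (?V E) h)" if "?H E" for E
    using simple[OF that] by (simp add: simple_graph_def matchable_def)
  ultimately have "finite S" unfolding S_def by blast
  moreover have "S \<noteq> {}"
  proof -
    obtain E where "?H E" using hard_exists[of P W n D] pos by blast
    then show ?thesis using unfin[of E] unfolding S_def finished_def by blast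
  qed
  moreover have "S \<subseteq> data_items"
    unfolding S_def using item_in_data_items[OF simple] by blast
  moreover have "linear_order_on data_items (priority A h)"
    using A(1) by (simp add: adaptive_priority_algorithm_def)
  ultimately obtain it where it: "it \<in> S" "\<forall>it'\<in>S. (it, it') \<in> priority A h"
    using linear_order_least by metis
  then obtain r N E1 where E1: "?H E1" "r \<in> matchable (?V E1) h" "N = neighbors (E0 \<union> E1) r"
    "it = (r, N)" unfolding S_def by blast
  have rec: "receives A (?V E) (E0 \<union> E) h (r, N)"
    if "?H E" "r \<in> matchable (?V E) h" "neighbors (E0 \<union> E) r = N" for E
  proof -
    have "(y, neighbors (E0 \<union> E) y) \<in> S" if "y \<in> matchable (?V E) h" for y
      unfolding S_def using that \<open>?H E\<close> by auto
    then show ?thesis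
      unfolding receives_def using that(2,3) it(2) E1(4) by auto
  qed
  have rec1: "receives A (?V E1) (E0 \<union> E1) h (r, N)" using rec E1 by blast
  have r: "r \<notin> ?X" "r \<notin> isolated_nodes h" "r \<in> ?V E1"
    using E1(2) by (auto simp: matchable_def)
  show ?case
  proof (cases "r \<in> W")
    case True
    then have N: "N = neighbors E1 r" and rE1: "r \<in> \<Union>E1"
      using E1(3) nb_W E0(2) r(3) by auto
    have "N \<inter> matchable (?V E1) h \<noteq> {}"
      using nb_matchable[OF E1(1) True rE1] N by blast
    then obtain s where s: "s \<in> N" "s \<in> matchable (?V E1) h" "decide A h (r, N) = Some s"
      using A(2) simple[OF E1(1)] run[OF E1(1)] unfin[OF E1(1)] rec1 unfolding greedy_def by blast
    \<comment> \<open>Pending nodes are matched already, so a legal partner is never one of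
      them.\<close>
    then have "s \<in> N - P" using X(1) by (auto simp: matchable_def)
    moreover have "run A (?V E) (E0 \<union> E) (h @ [((r, N), Some s)])"
      if E: "?H E" "neighbors E r = N" for E
    proof -
      have "r \<in> \<Union>E" using E(2) s(1) neighbors_empty_if_notin[of r E] by blast
      then have "receives A (?V E) (E0 \<union> E) h (r, N)"
        using rec[OF E(1)] W_matchable nb_W E(2) True by blast
      then show ?thesis
        using run.round[OF run[OF E(1)] unfin[OF E(1)]] s(3) by metis
    qed
    ultimately show ?thesis
      using less.prems E1(1) True rE1 N by blast
  next
    case False
    have rP: "r \<notin> P" using r(1) X(1) by blast
    then have r_notin: "r \<notin> \<Union>E" if "?H E" for E
      using False hard_edges[OF that] by blast
    then have rE0: "r \<in> \<Union>E0" using r(3) E1(1) by blast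
    have nb: "neighbors (E0 \<union> E) r = neighbors E0 r" if "?H E" for E
      using neighbors_empty_if_notin[OF r_notin[OF that]] by (simp add: neighbors_Un)
    \<comment> \<open>Each committed edge has a matched end, and \<open>r\<close> is not
      matched.\<close>
    have "N \<subseteq> ?X"
      using nb[OF E1(1)] E1(3) E0(4) r(1) unfolding neighbors_def by blast
    then have "N \<inter> matchable (?V E1) h = {}" by (auto simp: matchable_def)
    then have "decide A h (r, N) \<noteq> Some v" for v
      using A(1) simple[OF E1(1)] run[OF E1(1)] unfin[OF E1(1)] rec1
      unfolding adaptive_priority_algorithm_def by blast
    then have dec: "decide A h (r, N) = None" by auto
    let ?h = "h @ [((r, N), None)]"
    have "run A (?V E) (E0 \<union> E) ?h" if E: "?H E" for E
    proof -
      have "r \<in> matchable (?V E) h" using rE0 r by (auto simp: matchable_def)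
      then have "receives A (?V E) (E0 \<union> E) h (r, N)"
        using rec[OF E] nb[OF E] nb[OF E1(1)] E1(3) by simp
      then show ?thesis using run.round[OF run[OF E] unfin[OF E]] dec by metis
    qed
    then have "position A D n P W E0 ?h"
      using pos False unfolding position_def matching_of_simps isolated_nodes_simps by simp
    moreover have "card (\<Union>E0 - isolated_nodes ?h) < card (\<Union>E0 - isolated_nodes h)"
    proof (rule psubset_card_mono)
      show "finite (\<Union>E0 - isolated_nodes h)"
        using E0(1,3) by (metis card.infinite finite_Diff finite_Union zero_neq_numeral)
      show "\<Union>E0 - isolated_nodes ?h \<subset> \<Union>E0 - isolated_nodes h"
        using rE0 r(2) by (auto simp: isolated_nodes_simps)
    qed
    ultimately show ?thesis
      using less.hyps[of ?h] by (simp add: matching_of_simps)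
  qed
qed

text \<open>Each of the \<open>n + 1\<close> rounds counted here adds one edge to the algorithm's
  matching; afterwards every edge still available passes through \<open>w\<close>.\<close>

lemma position_forces_loss:
  assumes A: "adaptive_priority_algorithm A" "greedy A" and "position A D n P W E0 h"
  shows "\<exists>E h' w. hard D n P W E \<and> run A (\<Union>(E0 \<union> E)) (E0 \<union> E) h' \<and>
    card (matching_of h') \<le> card (matching_of h) + n + 1 \<and>
    (\<forall>e\<in>E0 \<union> E. e \<inter> \<Union>(matching_of h') = {} \<longrightarrow> w \<in> e)"
  using assms(3)
proof (induction n arbitrary: P W E0 h)
  case 0
  obtain h' r N s E1 where st: "position A D 0 P W E0 h'" "matching_of h' = matching_of h"
    "hard D 0 P W E1" "r \<in> W" "r \<in> \<Union>E1" "N = neighbors E1 r" "s \<in> N - P"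
    "\<And>E'. hard D 0 P W E' \<Longrightarrow> neighbors E' r = N \<Longrightarrow>
       run A (\<Union>(E0 \<union> E')) (E0 \<union> E') (h' @ [((r, N), Some s)])"
    using position_next_item[OF A 0] by metis
  note pos = st(1)[unfolded position_def]
  note N = hard_item[OF st(3-5), folded st(6)]
  \<comment> \<open>The configuration \<open>E1\<close> that supplied the item is discarded; only
    its admissible neighborhood is kept, and a graph is built in which the edge just matched plays
    \<open>uv\<close>.\<close>
  obtain E w where E: "hard D 0 P W E" "neighbors E r = N"
    "\<forall>e\<in>E. e \<inter> ({r, s} \<union> P) = {} \<longrightarrow> w \<in> e"
    using theta_realizes[of P W D r N s] pos st(4,7) N by auto
  let ?h = "h' @ [((r, N), Some s)]"
  have U: "\<Union>(matching_of ?h) = {r, s} \<union> \<Union>(matching_of h)"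
    using st(2) by (simp add: matching_of_simps)
  have "card (matching_of ?h) \<le> card (matching_of h) + 0 + 1"
    using st(2) finite_matching_of[of h] by (simp add: matching_of_simps card_insert_if)
  moreover have "\<forall>e\<in>E0 \<union> E. e \<inter> \<Union>(matching_of ?h) = {} \<longrightarrow> w \<in> e"
  proof (intro ballI impI)
    fix e assume e: "e \<in> E0 \<union> E" "e \<inter> \<Union>(matching_of ?h) = {}"
    then have "e \<inter> \<Union>(matching_of h) = {}" "e \<inter> ({r, s} \<union> P) = {}"
      using pos st(2) unfolding U by auto
    moreover from this have "e \<notin> E0" using pos st(2) by auto
    ultimately show "w \<in> e" using e(1) E(3) by auto
  qed
  ultimately show ?case
    using st(8)[OF E(1,2)] E(1) by blast
next
  case (Suc n)
  obtain h' r N s E1 where st: "position A D (Suc n) P W E0 h'" "matching_of h' = matching_of h"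
    "hard D (Suc n) P W E1" "r \<in> W" "r \<in> \<Union>E1" "N = neighbors E1 r" "s \<in> N - P"
    "\<And>E'. hard D (Suc n) P W E' \<Longrightarrow> neighbors E' r = N \<Longrightarrow>
       run A (\<Union>(E0 \<union> E')) (E0 \<union> E') (h' @ [((r, N), Some s)])"
    using position_next_item[OF A Suc.prems] by metis
  note pos = st(1)[unfolded position_def]
  note N = hard_item[OF st(3-5), folded st(6)]
  obtain I P' where I: "I \<subseteq> W - {r, s}" "P' \<subseteq> insert s P" "finite P'"
    "card P' + n + 3 \<le> D" "(n + 1) * (D + 3) \<le> card (W - {r, s} - I)"
    "\<And>E. hard D n P' (W - {r, s} - I) E \<Longrightarrow> hard D (Suc n) P W (fan_edges r s I (N \<inter> P) \<union> E)"
    "\<And>E. hard D n P' (W - {r, s} - I) E \<Longrightarrow> neighbors (fan_edges r s I (N \<inter> P) \<union> E) r = N"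
    using fan_realizes[of P W n D r N s] pos st(4,7) N by metis
  let ?F = "fan_edges r s I (N \<inter> P)" and ?W = "W - {r, s} - I" and ?h = "h' @ [((r, N), Some s)]"
  have U: "\<Union>(matching_of ?h) = {r, s} \<union> \<Union>(matching_of h')"
    by (simp add: matching_of_simps)
  have rs: "r \<noteq> s" "r \<notin> I" "s \<notin> I" "r \<notin> P" "s \<notin> P" "s \<in> W"
    using N st(4,7) I(1) pos by auto
  have finF: "finite ?F" "\<forall>e\<in>?F. card e = 2 \<and> e \<inter> {r, s} \<noteq> {}"
  proof -
    have "finite I" "finite (N \<inter> P)" using I(1) pos by (meson finite_Diff finite_Int finite_subset)+
    then show "finite ?F" by (simp add: fan_edges_def)
    show "\<forall>e\<in>?F. card e = 2 \<and> e \<inter> {r, s} \<noteq> {}"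
      using rs by (auto simp: fan_edges_def card_2_iff')
  qed
  \<comment> \<open>The fan is now committed. All its edges meet \<open>r\<close> or
    \<open>s\<close>, which are matched, so the exposed nodes can no longer be matched.\<close>
  have "position A D n P' ?W (E0 \<union> ?F) ?h"
    unfolding position_def
  proof (intro conjI)
    show "finite P'" "card P' + n + 3 \<le> D" "(n + 1) * (D + 3) \<le> card ?W" using I by auto
    show "finite ?W" "finite (E0 \<union> ?F)" using pos finF(1) by auto
    show "P' \<inter> ?W = {}" using I(2) pos by blast
    show "\<Union>(E0 \<union> ?F) \<inter> ?W = {}"
      using pos Union_fan[of r s I "N \<inter> P"] by auto
    show "\<forall>e\<in>E0 \<union> ?F. card e = 2 \<and> e \<inter> \<Union>(matching_of ?h) \<noteq> {}"
    proof
      fix e assume "e \<in> E0 \<union> ?F"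
      then show "card e = 2 \<and> e \<inter> \<Union>(matching_of ?h) \<noteq> {}"
      proof
        assume "e \<in> E0"
        then have "card e = 2" "e \<inter> \<Union>(matching_of h') \<noteq> {}" using pos by simp_all
        then show ?thesis unfolding U by blast
      next
        assume "e \<in> ?F"
        then have "card e = 2" "e \<inter> {r, s} \<noteq> {}" using finF(2) by simp_all
        then show ?thesis unfolding U by blast
      qed
    qed
    have "P \<subseteq> \<Union>(matching_of h')" "\<Union>(matching_of h') \<inter> W = {}" using pos by simp_all
    then show "P' \<subseteq> \<Union>(matching_of ?h)" "\<Union>(matching_of ?h) \<inter> ?W = {}"
      using I(2) unfolding U by auto
    show "isolated_nodes ?h \<inter> ?W = {}" using pos by (auto simp: isolated_nodes_simps)
    \<comment> \<open>Each candidate of the shorter game, with the fan added, is a candidate of the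
      longer one that shows \<open>r\<close> the set \<open>N\<close>.\<close>
    show "\<forall>E. hard D n P' ?W E \<longrightarrow> run A (\<Union>(E0 \<union> ?F \<union> E)) (E0 \<union> ?F \<union> E) ?h"
      using st(8)[OF I(6,7)] by (simp add: Un_assoc)
  qed
  from Suc.IH[OF this] obtain E h'' w where E: "hard D n P' ?W E"
    "run A (\<Union>((E0 \<union> ?F) \<union> E)) ((E0 \<union> ?F) \<union> E) h''"
    "card (matching_of h'') \<le> card (matching_of ?h) + n + 1"
    "\<forall>e\<in>(E0 \<union> ?F) \<union> E. e \<inter> \<Union>(matching_of h'') = {} \<longrightarrow> w \<in> e"
    by blast
  have "card (matching_of ?h) \<le> card (matching_of h) + 1"
    using st(2) finite_matching_of[of h] by (simp add: matching_of_simps card_insert_if)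
  then have "card (matching_of h'') \<le> card (matching_of h) + Suc n + 1" using E(3) by simp
  then show ?case
    using I(6)[OF E(1)] E(2,4) unfolding Un_assoc
    by (intro exI[of _ "?F \<union> E"] exI[of _ h''] exI[of _ w]) simp
qed

section \<open>Choice of parameters and the resulting ratio\<close>

theorem theorem8:
  fixes \<Delta> :: nat and A :: "'v algorithm"
  assumes "infinite (UNIV :: 'v set)"
    and "\<Delta> \<ge> 3"
    and "adaptive_priority_algorithm A"
    and "greedy A"
  shows "\<exists>(V :: 'v set) E. simple_graph V E \<and> E \<noteq> {} \<and>
    (\<forall>v\<in>V. card (neighbors E v) \<le> \<Delta>) \<and>
    real (card (computed_matching A V E))
      \<le> (real \<Delta> - 1) / (2 * real \<Delta> - 3) * real (matching_number E)"
proof -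
  \<comment> \<open>With no pending nodes, this is the largest \<open>n\<close> satisfying the
    degree budget \<open>card P + n + 3 \<le> \<Delta>\<close>.\<close>
  define n where "n = \<Delta> - 3"
  have n: "\<Delta> = n + 3" using assms(2) by (simp add: n_def)
  obtain W :: "'v set" where W: "finite W" "card W = (n + 1) * (\<Delta> + 3)"
    using infinite_arbitrarily_large[OF assms(1)] by blast
  have "position A \<Delta> n {} W {} []"
    using W n by (simp add: position_def matching_of_simps isolated_nodes_simps run.start)
  then obtain E h w where E: "hard \<Delta> n {} W E" "run A (\<Union>E) E h"
    "card (matching_of h) \<le> n + 1" "\<forall>e\<in>E. e \<inter> \<Union>(matching_of h) = {} \<longrightarrow> w \<in> e"
    using position_forces_loss[OF assms(3,4), of \<Delta> n "{}" W "{}" "[]"]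
    by (auto simp: matching_of_simps)
  have G: "simple_graph (\<Union>E) E" using simple_graph_hard[OF _ _ E(1), of "{}"] by simp
  have finE: "finite E" and neE: "E \<noteq> {}" and subE: "\<Union>E \<subseteq> W" using hard_edges[OF E(1)] by auto
  \<comment> \<open>No node is pending at the outset, so \<open>hard_item\<close> covers every
    vertex.\<close>
  have deg: "\<forall>v\<in>\<Union>E. card (neighbors E v) \<le> \<Delta>"
    using hard_item[OF E(1)] subE by (auto simp: admissible_def)
  let ?M = "computed_matching A (\<Union>E) E"
  \<comment> \<open>One edge at \<open>w\<close> on top of the \<open>n + 1\<close> counted ones
    makes \<open>n + 2 = \<Delta> - 1\<close>.\<close>
  have "card ?M \<le> card (matching_of h) + 1"
    using card_matching_through_node[OF run_matching_subset(2,1)[OF assms(3) G E(2)]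
        finite_matching_of E(4) finE] .
  then have M: "real (card ?M) \<le> real \<Delta> - 1" using E(3) n by simp
  \<comment> \<open>With \<open>P = {}\<close> the large matching has
    \<open>2 * n + 3 = 2 * \<Delta> - 3\<close> edges.\<close>
  obtain M' where "is_matching E M'" "card M' = 2 * n + 3"
    using hard_matching[OF E(1)] by auto
  moreover have "{M. is_matching E M} \<subseteq> Pow E" by (auto simp: is_matching_def)
  then have "finite {M. is_matching E M}" using finE by (simp add: finite_subset)
  ultimately have "2 * n + 3 \<le> matching_number E"
    unfolding matching_number_def by (metis (mono_tags) Max_ge finite_imageI imageI mem_Collect_eq)
  then have opt: "2 * real \<Delta> - 3 \<le> real (matching_number E)" using n by simp
  have pos: "0 < 2 * real \<Delta> - 3" using assms(2) by simp
  have "real (card ?M) \<le> (real \<Delta> - 1) / (2 * real \<Delta> - 3) * (2 * real \<Delta> - 3)"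
    using M pos by simp
  also have "\<dots> \<le> (real \<Delta> - 1) / (2 * real \<Delta> - 3) * real (matching_number E)"
    using opt pos assms(2) by (intro mult_left_mono) auto
  finally show ?thesis using G neE deg by blast
qed

end
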